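(* Let $f=[f^L,f^U]\colon\mathbb{R}^n\to\mathcal{K}_c$ be an interval-valued function and let the constraint set $X=\{x\in\mathbb{R}^n : g_j(x)\le 0,\ j=1,\dots,m\}$, with $g_j\colon\mathbb{R}^n\to\mathbb{R}$, be nonempty and closed. Assume that $f$ is lower-semicontinuous and $LU$-bounded from below on $X$ by an interval $B\in\mathcal{K}_c$. Then, for every $\mathcal{E}=[\epsilon^L,\epsilon^U]\in\mathcal{K}_c$ satisfying $0\prec^s_{LU}\mathcal{E}$, the problem of minimizing $f$ over $X$ admits at least one $\mathcal{E}$-quasi-$LU$-solution.
   Context: $\mathcal{K}_c$ is the set of all closed bounded intervals $[a^L,a^U]\subset\mathbb{R}$, $a^L\le a^U$; $0$ denotes the interval $[0,0]$. An interval-valued function is $f(x)=[f^L(x),f^U(x)]$ with $f^L,f^U\colon\mathbb{R}^n\to\mathbb{R}$ and $f^L(x)\le f^U(x)$ for all $x$; $f$ is called lower-semicontinuous if both $f^L$ and $f^U$ are lower-semicontinuous. Interval arithmetic: $[a^L,a^U]-[b^L,b^U]=[a^L-b^U,\,a^U-b^L]$, and $k[a^L,a^U]=[ka^L,ka^U]$ for real $k\ge0$. $\|\cdot\|$ is the Euclidean norm. Order: $[a^L,a^U]\preceq_{LU}[b^L,b^U]$ iff $a^L\le b^L$ and $a^U\le b^U$; $A\prec_{LU}B$ iff $A\preceq_{LU}B$ and $A\ne B$; $[a^L,a^U]\prec^s_{LU}[b^L,b^U]$ iff $a^L<b^L$ and $a^U<b^U$. $f$ is $LU$-bounded from below on $X$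 by $B\in\mathcal{K}_c$ if $B\preceq_{LU}f(x)$ for all $x\in X$. A point $x^*\in X$ is an $\mathcal{E}$-quasi-$LU$-solution if there is no $x\in X$ with $f(x)\prec_{LU}f(x^* )-\mathcal{E}\|x-x^*\|$. *)

theory Defs
  imports "HOL-Analysis.Analysis" "HOL-Library.Interval"
begin

text \<open>
  The set \<open>\<K>\<^sub>c\<close> of compact real intervals is the type \<^typ>\<open>real interval\<close>.  Its
  \<open>0\<close> and binary \<open>-\<close> are those of the paper, but its \<open>\<le>\<close> and \<open><\<close> are interval inclusion,
  hence the separate \<open>LU\<close>-orders below.
\<close>

definition le_LU :: "real interval \<Rightarrow> real interval \<Rightarrow> bool"  (infix \<open>\<preceq>\<^sub>L\<^sub>U\<close> 50) where
  "A \<preceq>\<^sub>L\<^sub>U B \<longleftrightarrow> lower A \<le> lower B \<and> upper A \<le> upper B"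

definition less_LU :: "real interval \<Rightarrow> real interval \<Rightarrow> bool"  (infix \<open>\<prec>\<^sub>L\<^sub>U\<close> 50) where
  "A \<prec>\<^sub>L\<^sub>U B \<longleftrightarrow> A \<preceq>\<^sub>L\<^sub>U B \<and> A \<noteq> B"

definition strict_less_LU :: "real interval \<Rightarrow> real interval \<Rightarrow> bool"  (infix \<open>\<prec>\<^sup>s\<^sub>L\<^sub>U\<close> 50) where
  "A \<prec>\<^sup>s\<^sub>L\<^sub>U B \<longleftrightarrow> lower A < lower B \<and> upper A < upper B"

text \<open>
  Multiplication by a scalar, as interval multiplication by \<open>[k, k]\<close>; the lemmas below give the
  endpoint formula for \<open>k \<ge> 0\<close>, the only case used.
\<close>

definition scale_interval :: "real \<Rightarrow> real interval \<Rightarrow> real interval"  (infixr \<open>\<cdot>\<^sub>I\<close> 75) where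
  "k \<cdot>\<^sub>I A = interval_of k * A"

lemma lower_scale_interval [simp]: "0 \<le> k \<Longrightarrow> lower (k \<cdot>\<^sub>I A) = k * lower A"
  by (simp add: scale_interval_def lower_times min_def mult_left_mono)

lemma upper_scale_interval [simp]: "0 \<le> k \<Longrightarrow> upper (k \<cdot>\<^sub>I A) = k * upper A"
  by (simp add: scale_interval_def upper_times max_def mult_left_mono)

definition lower_semicontinuous :: "('a::topological_space \<Rightarrow> real) \<Rightarrow> bool" where
  "lower_semicontinuous h \<longleftrightarrow> (\<forall>x. \<forall>c < h x. \<forall>\<^sub>F y in nhds x. c < h y)"

definition interval_lower_semicontinuous ::
    "('a::topological_space \<Rightarrow> real interval) \<Rightarrow> bool" where
  "interval_lower_semicontinuous f \<longleftrightarrow>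
     lower_semicontinuous (\<lambda>x. lower (f x)) \<and> lower_semicontinuous (\<lambda>x. upper (f x))"

definition LU_bounded_below_on :: "'a set \<Rightarrow> ('a \<Rightarrow> real interval) \<Rightarrow> real interval \<Rightarrow> bool" where
  "LU_bounded_below_on X f B \<longleftrightarrow> (\<forall>x\<in>X. B \<preceq>\<^sub>L\<^sub>U f x)"

definition feasible_set :: "nat \<Rightarrow> (nat \<Rightarrow> 'a \<Rightarrow> real) \<Rightarrow> 'a set" where
  "feasible_set m g = {x. \<forall>j\<in>{1..m}. g j x \<le> 0}"

definition quasi_LU_solution ::
    "real interval \<Rightarrow> ('a::real_normed_vector \<Rightarrow> real interval) \<Rightarrow> 'a set \<Rightarrow> 'a \<Rightarrow> bool" where
  "quasi_LU_solution E f X x' \<longleftrightarrow>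
     x' \<in> X \<and> \<not> (\<exists>x\<in>X. f x \<prec>\<^sub>L\<^sub>U f x' - norm (x - x') \<cdot>\<^sub>I E)"

end

theory Submission
  imports Defs
begin

text \<open>
  In finite dimension Ekeland's principle is not needed.  With \<open>h = f\<^sup>L + f\<^sup>U\<close> and
  \<open>c = \<epsilon>\<^sup>L + \<epsilon>\<^sup>U > 0\<close>, the function \<open>x \<mapsto> h x + c \<parallel>x - x\<^sub>0\<parallel>\<close> is lower semicontinuous and coercive on
  the closed set \<open>X\<close>, so it has a minimizer \<open>x\<^sup>*\<close>, and the triangle inequality turns minimality into
  \<open>h x\<^sup>* \<le> h x + c \<parallel>x - x\<^sup>*\<parallel>\<close> on \<open>X\<close>.  Adding the two endpoint inequalities of
  \<open>f x \<prec>\<^sub>L\<^sub>U f x\<^sup>* - \<E> \<parallel>x - x\<^sup>*\<parallel>\<close>, one of which is strict, would contradict this.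
\<close>

lemma lower_semicontinuous_add:
  assumes "lower_semicontinuous h" "lower_semicontinuous k"
  shows "lower_semicontinuous (\<lambda>x. h x + k x)"
  unfolding lower_semicontinuous_def
proof (intro allI impI)
  fix x c assume "c < h x + k x"
  \<comment> \<open>Half the gap above \<open>c\<close>: each summand may drop by \<open>d\<close>,
    and the two drops together use up exactly the gap.\<close>
  define d where "d = (h x + k x - c) / 2"
  have "0 < d"
    using \<open>c < h x + k x\<close> by (simp add: d_def)
  then have "\<forall>\<^sub>F y in nhds x. h x - d < h y" "\<forall>\<^sub>F y in nhds x. k x - d < k y"
    using assms by (auto simp: lower_semicontinuous_def)
  then show "\<forall>\<^sub>F y in nhds x. c < h y + k y"
    by eventually_elim (simp add: d_def field_simps)
qed

lemma continuous_imp_lower_semicontinuous: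
  assumes "continuous_on UNIV h"
  shows "lower_semicontinuous h"
  unfolding lower_semicontinuous_def
proof (intro allI impI)
  fix x c assume "c < h x"
  moreover have "open {y. c < h y}"
    using assms by (intro open_Collect_less continuous_on_const)
  ultimately show "\<forall>\<^sub>F y in nhds x. c < h y"
    by (auto simp: eventually_nhds)
qed

text \<open>Without a minimizer, the open superlevel sets \<open>{y. h z < h y}\<close> for
  \<open>z\<close> in \<open>K\<close> cover \<open>K\<close>. In a finite subcover, an index
  \<open>z\<close> with least value \<open>h z\<close> is itself a point of \<open>K\<close> that no
  chosen set contains.\<close>

lemma lower_semicontinuous_attains_inf:
  assumes h: "lower_semicontinuous h" and "compact K" "K \<noteq> {}"
  shows "\<exists>x\<in>K. \<forall>y\<in>K. h x \<le> h y"
proof (rule ccontr)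
  assume "\<not> ?thesis"
  then have no_min: "\<And>x. x \<in> K \<Longrightarrow> \<exists>y\<in>K. h y < h x"
    by (auto simp: not_le)
  have "open {y. h z < h y}" for z
    unfolding open_subopen[of "{y. h z < h y}"]
    using h by (fastforce simp: lower_semicontinuous_def eventually_nhds)
  moreover have "K \<subseteq> (\<Union>z\<in>K. {y. h z < h y})"
    using no_min by blast
  ultimately obtain F where F: "F \<subseteq> K" "finite F" "K \<subseteq> (\<Union>z\<in>F. {y. h z < h y})"
    using compactE_image[OF \<open>compact K\<close>, of K "\<lambda>z. {y. h z < h y}"] by blast
  then have "F \<noteq> {}"
    using \<open>K \<noteq> {}\<close> by auto
  then obtain z where "z \<in> F" "\<And>w. w \<in> F \<Longrightarrow> h z \<le> h w"
    using ex_min_if_finite[of "h ` F"] \<open>finite F\<close> by (force simp: not_less)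
  then show False
    using F by (fastforce simp: not_less[symmetric])
qed

lemma ex_almost_minimal_point:
  fixes h :: "'a::{real_normed_vector,heine_borel} \<Rightarrow> real"
  assumes h: "lower_semicontinuous h" and "closed X" "X \<noteq> {}"
    and bound: "\<And>x. x \<in> X \<Longrightarrow> b \<le> h x" and "0 < c"
  shows "\<exists>x'\<in>X. \<forall>x\<in>X. h x' \<le> h x + c * norm (x - x')"
proof -
  obtain x0 where "x0 \<in> X"
    using \<open>X \<noteq> {}\<close> by blast
  \<comment> \<open>Beyond distance \<open>R\<close> from \<open>x0\<close> the penalty exceeds
    \<open>h x0 - b\<close>, so there \<open>\<phi>\<close> is larger than \<open>\<phi> x0\<close>.
    A minimizer on the compact set \<open>X \<inter> cball x0 R\<close> is then one on all of
    \<open>X\<close>.\<close>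
  define R where "R = (h x0 - b) / c"
  define \<phi> where "\<phi> x = h x + c * dist x x0" for x
  have "0 \<le> R"
    using bound[OF \<open>x0 \<in> X\<close>] \<open>0 < c\<close> by (simp add: R_def)
  have "lower_semicontinuous \<phi>"
    unfolding \<phi>_def
    by (intro lower_semicontinuous_add h continuous_imp_lower_semicontinuous continuous_intros)
  moreover have "compact (X \<inter> cball x0 R)"
    using \<open>closed X\<close> by (intro closed_Int_compact compact_cball)
  moreover have "x0 \<in> X \<inter> cball x0 R"
    using \<open>x0 \<in> X\<close> \<open>0 \<le> R\<close> by simp
  ultimately obtain x' where x': "x' \<in> X" "\<And>x. x \<in> X \<inter> cball x0 R \<Longrightarrow> \<phi> x' \<le> \<phi> x"
    using lower_semicontinuous_attains_inf[of \<phi> "X \<inter> cball x0 R"] by blast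
  have min: "\<phi> x' \<le> \<phi> x" if "x \<in> X" for x
  proof (cases "x \<in> cball x0 R")
    case True
    then show ?thesis
      using x' that by blast
  next
    case False
    then have "h x0 - b < c * dist x x0"
      using \<open>0 < c\<close> by (simp add: R_def field_simps dist_commute)
    then have "\<phi> x0 \<le> \<phi> x"
      using bound[OF that] by (simp add: \<phi>_def)
    moreover have "\<phi> x' \<le> \<phi> x0"
      using x' \<open>x0 \<in> X \<inter> cball x0 R\<close> by blast
    ultimately show ?thesis
      by simp
  qed
  have "h x' \<le> h x + c * norm (x - x')" if "x \<in> X" for x
  proof -
    have "c * dist x x0 \<le> c * (dist x x' + dist x' x0)"
      using \<open>0 < c\<close> by (simp add: dist_triangle)
    then show ?thesis
      using min[OF that] by (simp add: \<phi>_def dist_norm[of x x'] distrib_left)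
  qed
  with x' show ?thesis
    by blast
qed

lemma less_LU_imp_sum_less:
  assumes "A \<prec>\<^sub>L\<^sub>U B"
  shows "lower A + upper A < lower B + upper B"
  using assms by (auto simp: less_LU_def le_LU_def interval_eq_iff)

theorem theorem3p2:
  fixes f :: "real ^ 'n \<Rightarrow> real interval"
    and g :: "nat \<Rightarrow> real ^ 'n \<Rightarrow> real"
    and m :: nat
    and B E :: "real interval"
  assumes "feasible_set m g \<noteq> {}"
    and "closed (feasible_set m g)"
    and "interval_lower_semicontinuous f"
    and "LU_bounded_below_on (feasible_set m g) f B"
    and "0 \<prec>\<^sup>s\<^sub>L\<^sub>U E"
  shows "\<exists>x'. quasi_LU_solution E f (feasible_set m g) x'"
proof -
  let ?X = "feasible_set m g" and ?h = "\<lambda>x. lower (f x) + upper (f x)"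
  have "lower_semicontinuous ?h"
    using assms(3) by (simp add: interval_lower_semicontinuous_def lower_semicontinuous_add)
  moreover have "\<And>x. x \<in> ?X \<Longrightarrow> lower B + upper B \<le> ?h x"
    using assms(4) by (force simp: LU_bounded_below_on_def le_LU_def)
  moreover have "0 < lower E + upper E"
    using assms(5) by (simp add: strict_less_LU_def)
  ultimately obtain x' where x': "x' \<in> ?X"
    "\<And>x. x \<in> ?X \<Longrightarrow> ?h x' \<le> ?h x + (lower E + upper E) * norm (x - x')"
    using ex_almost_minimal_point[of ?h ?X] assms(1,2) by blast
  have "\<not> f x \<prec>\<^sub>L\<^sub>U f x' - norm (x - x') \<cdot>\<^sub>I E" if "x \<in> ?X" for x
  proof
    assume "f x \<prec>\<^sub>L\<^sub>U f x' - norm (x - x') \<cdot>\<^sub>I E"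
    \<comment> \<open>Interval subtraction takes \<open>upper E\<close> from the lower endpoint and
      \<open>lower E\<close> from the upper one; the swap disappears in the sum of the
      endpoints.\<close>
    from less_LU_imp_sum_less[OF this] x'(2)[OF that] show False
      by (simp add: algebra_simps)
  qed
  with x' show ?thesis
    by (auto simp: quasi_LU_solution_def)
qed

end
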